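(* Let $\alpha,\beta\in\mathbb{R}$ and $\delta,\varepsilon>0$ satisfy $\alpha\neq\beta$ and $(\alpha-\beta)\delta+\varepsilon^2-\delta^2\neq0$, and let $\mathcal{E}=\{e^{(1)},\dots,e^{(12)}\}$ be the set of transformation strains of monoclinic-I martensite with these lattice parameters. If $\varepsilon>\delta$, then the convex hull of $\mathcal{E}$ has exactly 33 four-dimensional facets, namely the convex hulls of $\{e^{(i)}: i\in I\}$ for the following index sets $I$: (1) 12 facets with 5 vertices each, whose index sets are the images under $r_0$ of those of the five-vertex facets occurring when $\varepsilon<\delta$: $\{1,2,3,5,12\}$, $\{1,2,4,8,9\}$, $\{1,3,4,7,11\}$, $\{1,5,6,7,11\}$, $\{1,7,9,10,11\}$, $\{2,3,4,6,10\}$, $\{2,6,7,8,10\}$, $\{2,6,10,11,12\}$, $\{3,5,7,8,12\}$, $\{3,5,9,10,12\}$, $\{4,5,6,8,9\}$, $\{4,8,9,11,12\}$; (2) 12 other facets with 5 vertices each (the collection of whose index sets is invariant under $r_0$): $\{1,3,5,9,12\}$, $\{1,3,7,10,11\}$, $\{1,4,5,8,9\}$, $\{1,4,6,7,11\}$, $\{1,5,7,9,11\}$, $\{2,3,5,8,12\}$, $\{2,3,6,7,10\}$, $\{2,4,6,10,11\}$, $\{2,4,8,9,12\}$, $\{2,6,8,10,12\}$, $\{3,5,7,10,12\}$, $\{4,6,8,9,11\}$; (3) 6 facets, each of which is a pair of pairwise compatible three-tuples (its vertex set is the union of two disjoint three-tuples, each consisting of pairwise compatible strains): $\{1,2,5,8,9,12\}$,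 $\{1,3,5,7,9,10\}$, $\{1,4,5,6,9,11\}$, $\{2,3,7,8,10,12\}$, $\{2,4,6,8,11,12\}$, $\{3,4,6,7,10,11\}$; (4) 3 facets with 8 vertices each, each with index set invariant under $r_0$: $\{1,2,3,4,5,6,7,8\}$, $\{1,2,3,4,9,10,11,12\}$, $\{5,6,7,8,9,10,11,12\}$.
   Context: Write $M(a,b,c;p,q,s)$ for the real symmetric $3\times 3$ matrix with diagonal entries $a,b,c$, $(1,2)$-entry $p$, $(1,3)$-entry $q$ and $(2,3)$-entry $s$. The twelve transformation strains of monoclinic-I martensite with lattice parameters $\alpha,\beta,\delta,\varepsilon$ are $e^{(1)}=M(\alpha,\alpha,\beta;\delta,\varepsilon,\varepsilon)$, $e^{(2)}=M(\alpha,\alpha,\beta;\delta,-\varepsilon,-\varepsilon)$, $e^{(3)}=M(\alpha,\alpha,\beta;-\delta,-\varepsilon,\varepsilon)$, $e^{(4)}=M(\alpha,\alpha,\beta;-\delta,\varepsilon,-\varepsilon)$, $e^{(5)}=M(\alpha,\beta,\alpha;\varepsilon,\delta,\varepsilon)$, $e^{(6)}=M(\alpha,\beta,\alpha;-\varepsilon,\delta,-\varepsilon)$, $e^{(7)}=M(\alpha,\beta,\alpha;-\varepsilon,-\delta,\varepsilon)$, $e^{(8)}=M(\alpha,\beta,\alpha;\varepsilon,-\delta,-\varepsilon)$, $e^{(9)}=M(\beta,\alpha,\alpha;\varepsilon,\varepsilon,\delta)$, $e^{(10)}=M(\beta,\alpha,\alpha;-\varepsilon,-\varepsilon,\delta)$,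 $e^{(11)}=M(\beta,\alpha,\alpha;-\varepsilon,\varepsilon,-\delta)$, $e^{(12)}=M(\beta,\alpha,\alpha;\varepsilon,-\varepsilon,-\delta)$. The convex hull of $\mathcal{E}$ is a five-dimensional polytope (in the affine space of symmetric matrices of trace $2\alpha+\beta$); its facets are its extreme subsets (faces) of codimension one. $r_0$ is the permutation of $\{1,\dots,12\}$ interchanging $1\leftrightarrow2$, $3\leftrightarrow4$, $5\leftrightarrow6$, $7\leftrightarrow8$, $9\leftrightarrow10$, $11\leftrightarrow12$. The index sets of the five-vertex facets occurring when $\varepsilon<\delta$ are $\{1,2,3,7,10\}$, $\{1,2,4,6,11\}$, $\{1,3,4,5,9\}$, $\{1,5,7,8,9\}$, $\{1,5,9,11,12\}$, $\{2,3,4,8,12\}$, $\{2,5,6,8,12\}$, $\{2,8,9,10,12\}$, $\{3,5,6,7,10\}$, $\{3,7,10,11,12\}$, $\{4,6,7,8,11\}$, $\{4,6,9,10,11\}$. Two real symmetric $3\times3$ matrices $e,f$ are compatible if there exist $a,b\in\mathbb{R}^3$ with $e-f=\frac12(a\otimes b+b\otimes a)$. *)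

theory Defs
  imports "HOL-Analysis.Analysis"
begin

definition sym_mat :: "real \<Rightarrow> real \<Rightarrow> real \<Rightarrow> real \<Rightarrow> real \<Rightarrow> real \<Rightarrow> real^3^3" where
  "sym_mat a b c p q s =
     vector [vector [a, p, q],
             vector [p, b, s],
             vector [q, s, c]]"

(* The strains are numbered 1, ..., 12; the value at other indices is irrelevant. *)
definition strain :: "real \<Rightarrow> real \<Rightarrow> real \<Rightarrow> real \<Rightarrow> nat \<Rightarrow> real^3^3" where
  "strain \<alpha> \<beta> \<delta> \<epsilon> i =
     [sym_mat \<alpha> \<alpha> \<beta> \<delta> \<epsilon> \<epsilon>,
      sym_mat \<alpha> \<alpha> \<beta> \<delta> (-\<epsilon>) (-\<epsilon>),
      sym_mat \<alpha> \<alpha> \<beta> (-\<delta>) (-\<epsilon>) \<epsilon>,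
      sym_mat \<alpha> \<alpha> \<beta> (-\<delta>) \<epsilon> (-\<epsilon>),
      sym_mat \<alpha> \<beta> \<alpha> \<epsilon> \<delta> \<epsilon>,
      sym_mat \<alpha> \<beta> \<alpha> (-\<epsilon>) \<delta> (-\<epsilon>),
      sym_mat \<alpha> \<beta> \<alpha> (-\<epsilon>) (-\<delta>) \<epsilon>,
      sym_mat \<alpha> \<beta> \<alpha> \<epsilon> (-\<delta>) (-\<epsilon>),
      sym_mat \<beta> \<alpha> \<alpha> \<epsilon> \<epsilon> \<delta>,
      sym_mat \<beta> \<alpha> \<alpha> (-\<epsilon>) (-\<epsilon>) \<delta>,
      sym_mat \<beta> \<alpha> \<alpha> (-\<epsilon>) \<epsilon> (-\<delta>),
      sym_mat \<beta> \<alpha> \<alpha> \<epsilon> (-\<epsilon>) (-\<delta>)] ! (i - 1)"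

definition strain_hull :: "real \<Rightarrow> real \<Rightarrow> real \<Rightarrow> real \<Rightarrow> nat set \<Rightarrow> (real^3^3) set" where
  "strain_hull \<alpha> \<beta> \<delta> \<epsilon> I = convex hull (strain \<alpha> \<beta> \<delta> \<epsilon> ` I)"

definition vertices :: "(real^3^3) set \<Rightarrow> (real^3^3) set" where
  "vertices F = {v. v extreme_point_of F}"

definition outer :: "real^3 \<Rightarrow> real^3 \<Rightarrow> real^3^3" where
  "outer a b = (\<chi> i j. a $ i * b $ j)"

definition compatible :: "real^3^3 \<Rightarrow> real^3^3 \<Rightarrow> bool" where
  "compatible e f \<longleftrightarrow> (\<exists>a b. e - f = (1/2) *\<^sub>R (outer a b + outer b a))"

(* The involution 1 <-> 2, 3 <-> 4, ..., 11 <-> 12. *)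
definition r0 :: "nat \<Rightarrow> nat" where
  "r0 i = (if i \<in> {1..12} then (if odd i then i + 1 else i - 1) else i)"

(* Index sets of the five-vertex facets in the regime \<epsilon> < \<delta>. *)
definition five_vertex_small_eps :: "nat set set" where
  "five_vertex_small_eps =
     {{1, 2, 3, 7, 10}, {1, 2, 4, 6, 11}, {1, 3, 4, 5, 9}, {1, 5, 7, 8, 9},
      {1, 5, 9, 11, 12}, {2, 3, 4, 8, 12}, {2, 5, 6, 8, 12}, {2, 8, 9, 10, 12},
      {3, 5, 6, 7, 10}, {3, 7, 10, 11, 12}, {4, 6, 7, 8, 11}, {4, 6, 9, 10, 11}}"

(* Index sets of the four families of facets in the regime \<epsilon> > \<delta>. *)
definition r0_image_facets :: "nat set set" where
  "r0_image_facets =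
     {{1, 2, 3, 5, 12}, {1, 2, 4, 8, 9}, {1, 3, 4, 7, 11}, {1, 5, 6, 7, 11},
      {1, 7, 9, 10, 11}, {2, 3, 4, 6, 10}, {2, 6, 7, 8, 10}, {2, 6, 10, 11, 12},
      {3, 5, 7, 8, 12}, {3, 5, 9, 10, 12}, {4, 5, 6, 8, 9}, {4, 8, 9, 11, 12}}"

definition r0_invariant_facets :: "nat set set" where
  "r0_invariant_facets =
     {{1, 3, 5, 9, 12}, {1, 3, 7, 10, 11}, {1, 4, 5, 8, 9}, {1, 4, 6, 7, 11},
      {1, 5, 7, 9, 11}, {2, 3, 5, 8, 12}, {2, 3, 6, 7, 10}, {2, 4, 6, 10, 11},
      {2, 4, 8, 9, 12}, {2, 6, 8, 10, 12}, {3, 5, 7, 10, 12}, {4, 6, 8, 9, 11}}"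

definition three_tuple_pair_facets :: "nat set set" where
  "three_tuple_pair_facets =
     {{1, 2, 5, 8, 9, 12}, {1, 3, 5, 7, 9, 10}, {1, 4, 5, 6, 9, 11}, {2, 3, 7, 8, 10, 12},
      {2, 4, 6, 8, 11, 12}, {3, 4, 6, 7, 10, 11}}"

definition eight_vertex_facets :: "nat set set" where
  "eight_vertex_facets =
     {{1, 2, 3, 4, 5, 6, 7, 8}, {1, 2, 3, 4, 9, 10, 11, 12}, {5, 6, 7, 8, 9, 10, 11, 12}}"

end

theory Submission
  imports Defs
begin

text \<open>
  The strains fall into three classes of four, according to the position of the diagonal entry
  \<open>\<beta>\<close>. The off-diagonal entries of a class are the vertices of a tetrahedron
  \<open>{(x * l, y * m, z * n) : x, y, z = \<plusminus>1, x * y * z = 1}\<close>, where \<open>(l, m, n)\<close> is \<open>\<delta>\<close> in the place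
  belonging to the class and \<open>\<epsilon>\<close> in the other two. As \<open>\<alpha> \<noteq> \<beta>\<close>, the diagonals of the three classes are
  affinely independent, so the hull is the Cayley polytope of three tetrahedra in three-space.
  A linear functional on it is a direction \<open>(p, q, s)\<close> together with one independent constant per
  class (\<open>height\<close>).

  For direction zero, a maximal face is the join of two of the three classes: the facets with eight
  vertices. For the other directions, the group generated by permuting the coordinates and
  flipping an even number of signs, which permutes the strains, brings the direction into the
  chamber \<open>\<bar>s\<bar> \<le> q \<le> p\<close>. The common refinement of the normal fans of the three tetrahedra has only
  three rays in this chamber, namely \<open>(1, 0, 0)\<close>, \<open>(\<epsilon>, \<epsilon>, - \<delta>)\<close> and \<open>(\<epsilon>, \<delta>, - \<delta>)\<close>; they
  give the facets \<open>{1, 2, 5, 8, 9, 12}\<close>, \<open>{1, 4, 5, 8, 9}\<close> and \<open>{1, 2, 4, 8, 9}\<close>. Their orbits have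
  6, 12 and 12 elements, which with the three facets of direction zero makes 33.

  To turn this into a proof, three things are shown: each listed index set is cut out by a
  supporting hyperplane (\<open>exposed_facet_indices\<close>), each supporting hyperplane meets the
  strains inside a listed index set (\<open>zero_set_in_facet_indices\<close>), and no listed index set contains
  another. By \<open>facets_of_convex_hull\<close> the listed sets then give exactly the facets, so that the
  dimension of no individual face has to be computed; only the hull itself is shown to have
  dimension five. All strains have the same Frobenius norm, hence each is a vertex of every hull it
  helps to span.
\<close>

section \<open>Facets of the convex hull of a finite set\<close>

lemma face_of_convex_hull_supporting:
  fixes S :: "'a::euclidean_space set"
  assumes "finite S" "\<And>x. x \<in> S \<Longrightarrow> a \<bullet> x \<le> b"
  shows "convex hull {x \<in> S. a \<bullet> x = b} face_of convex hull S"
    and "convex hull S \<inter> {x. a \<bullet> x = b} = convex hull {x \<in> S. a \<bullet> x = b}"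
proof -
  have "convex hull S \<subseteq> {x. a \<bullet> x \<le> b}"
    using assms(2) by (intro hull_minimal) (auto simp: convex_halfspace_le)
  then have face: "convex hull S \<inter> {x. a \<bullet> x = b} face_of convex hull S"
    by (intro face_of_Int_supporting_hyperplane_le) auto
  then obtain S' where S': "S' \<subseteq> S" "convex hull S \<inter> {x. a \<bullet> x = b} = convex hull S'"
    using face_of_convex_hull_subset[OF finite_imp_compact[OF assms(1)]] by blast
  have "S' \<subseteq> {x \<in> S. a \<bullet> x = b}"
    using S' hull_subset[of S' convex] by blast
  then have "convex hull S' \<subseteq> convex hull {x \<in> S. a \<bullet> x = b}"
    by (rule hull_mono)
  moreover have "convex hull {x \<in> S. a \<bullet> x = b} \<subseteq> convex hull S \<inter> {x. a \<bullet> x = b}"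
    by (intro hull_minimal) (auto simp: hull_inc convex_Int convex_hyperplane)
  ultimately show "convex hull S \<inter> {x. a \<bullet> x = b} = convex hull {x \<in> S. a \<bullet> x = b}"
    using S'(2) by blast
  with face show "convex hull {x \<in> S. a \<bullet> x = b} face_of convex hull S"
    by simp
qed

text \<open>
  The dimension of the members of \<open>\<F>\<close> is not part of the hypotheses. A facet lies in some proper
  face spanned by a member of \<open>\<F>\<close>, and equals it because dimension drops strictly along proper
  faces. Conversely a member spans a face inside some facet, which is itself spanned by a member, and
  the antichain condition identifies the two.
\<close>

lemma facets_of_convex_hull:
  fixes S :: "'a::euclidean_space set"
  assumes "finite S"
    and face: "\<And>T. T \<in> \<F> \<Longrightarrow> convex hull T face_of convex hull S"
    and proper: "\<And>T. T \<in> \<F> \<Longrightarrow> convex hull T \<noteq> convex hull S"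
    and nonempty: "\<And>T. T \<in> \<F> \<Longrightarrow> T \<noteq> {}"
    and cover: "\<And>a b. \<lbrakk>\<forall>x\<in>S. a \<bullet> x \<le> b; \<exists>x\<in>S. a \<bullet> x < b\<rbrakk> \<Longrightarrow> \<exists>T\<in>\<F>. {x \<in> S. a \<bullet> x = b} \<subseteq> T"
    and antichain: "\<And>T T'. \<lbrakk>T \<in> \<F>; T' \<in> \<F>; convex hull T \<subseteq> convex hull T'\<rbrakk> \<Longrightarrow> T = T'"
  shows "{G. G facet_of convex hull S} = (hull) convex ` \<F>"
proof -
  have poly: "polyhedron (convex hull S)"
    using assms(1) by (intro polytope_imp_polyhedron polytope_convex_hull)
  have listed: "\<exists>T\<in>\<F>. G = convex hull T" if G: "G facet_of convex hull S" for G
  proof -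
    obtain a b where ab: "convex hull S \<subseteq> {x. a \<bullet> x \<le> b}"
        and G_eq: "G = convex hull S \<inter> {x. a \<bullet> x = b}"
      using facet_of_polyhedron[OF poly G] by metis
    have le: "\<forall>x\<in>S. a \<bullet> x \<le> b"
      using ab hull_subset[of S convex] by blast
    have G_hull: "G = convex hull {x \<in> S. a \<bullet> x = b}"
      using face_of_convex_hull_supporting(2)[OF assms(1)] le G_eq by metis
    have "G \<noteq> convex hull S"
      using G by (auto simp: facet_of_def)
    then have "{x \<in> S. a \<bullet> x = b} \<noteq> S"
      using G_hull by metis
    then have "\<exists>x\<in>S. a \<bullet> x < b"
      using le by force
    then obtain T where T: "T \<in> \<F>" "{x \<in> S. a \<bullet> x = b} \<subseteq> T"
      using cover le by blast
    then have "G \<subseteq> convex hull T"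
      using G_hull hull_mono by metis
    then have G_face: "G face_of convex hull T"
      using G face[OF T(1)] face_of_imp_subset face_of_subset facet_of_def by metis
    have "aff_dim (convex hull T) < aff_dim (convex hull S)"
      using face[OF T(1)] proper[OF T(1)] by (intro face_of_aff_dim_lt) auto
    then have "\<not> aff_dim G < aff_dim (convex hull T)"
      using G by (auto simp: facet_of_def)
    then have "G = convex hull T"
      using face_of_aff_dim_lt[OF convex_convex_hull G_face] by blast
    with T(1) show ?thesis by blast
  qed
  have "convex hull T facet_of convex hull S" if T: "T \<in> \<F>" for T
  proof -
    have "convex hull T \<noteq> {}"
      using nonempty[OF T] by simp
    then obtain G where G: "G facet_of convex hull S" "convex hull T \<subseteq> G"
      using face_of_polyhedron_subset_facet[OF poly face[OF T] _ proper[OF T]] by metis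
    then obtain T' where "T' \<in> \<F>" "G = convex hull T'"
      using listed by blast
    with G T antichain show ?thesis by metis
  qed
  with listed show ?thesis by blast
qed

text \<open>
  For two different points \<open>a\<close>, \<open>x\<close> of a sphere about the origin, \<open>a \<bullet> x < a \<bullet> a\<close> by
  Cauchy-Schwarz; thus the hyperplane through \<open>a\<close> normal to \<open>a\<close> has all other points
  strictly on one side.
\<close>

lemma extreme_points_of_cospherical:
  fixes S :: "'a::euclidean_space set"
  assumes "compact S" and sphere: "\<And>x. x \<in> S \<Longrightarrow> x \<bullet> x = r"
  shows "{v. v extreme_point_of convex hull S} = S"
proof -
  have "a \<notin> convex hull (S - {a})" if a: "a \<in> S" for a
  proof -
    have "a \<bullet> x < r" if x: "x \<in> S" "x \<noteq> a" for x
    proof -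
      have "0 < (x - a) \<bullet> (x - a)"
        using x by simp
      also have "\<dots> = 2 * r - 2 * (a \<bullet> x)"
        using sphere[OF x(1)] sphere[OF a]
        by (simp add: inner_diff_left inner_diff_right inner_commute)
      finally show ?thesis by simp
    qed
    then have "convex hull (S - {a}) \<subseteq> {x. a \<bullet> x < r}"
      by (intro hull_minimal convex_halfspace_lt) auto
    with sphere[OF a] show ?thesis by auto
  qed
  then show ?thesis
    using extreme_point_of_convex_hull_convex_independent[OF assms(1)] by blast
qed

section \<open>Linear functionals on the strains\<close>

text \<open>
  Up to an additive constant, these are the values on the strains of an arbitrary linear functional:
  \<open>p, q, s\<close> weight the off-diagonal entries, and \<open>a\<close>, \<open>b\<close>, \<open>c\<close> are the contributions of the
  diagonal for the strains having \<open>\<beta>\<close> in the first, second and third diagonal place.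
\<close>

definition height ::
  "real \<Rightarrow> real \<Rightarrow> real \<Rightarrow> real \<Rightarrow> real \<Rightarrow> real \<Rightarrow> real \<Rightarrow> real \<Rightarrow> nat \<Rightarrow> real" where
  "height \<delta> \<epsilon> a b c p q s i =
     [c + \<delta> * p + \<epsilon> * q + \<epsilon> * s, c + \<delta> * p - \<epsilon> * q - \<epsilon> * s,
      c - \<delta> * p - \<epsilon> * q + \<epsilon> * s, c - \<delta> * p + \<epsilon> * q - \<epsilon> * s,
      b + \<epsilon> * p + \<delta> * q + \<epsilon> * s, b - \<epsilon> * p + \<delta> * q - \<epsilon> * s,
      b - \<epsilon> * p - \<delta> * q + \<epsilon> * s, b + \<epsilon> * p - \<delta> * q - \<epsilon> * s,
      a + \<epsilon> * p + \<epsilon> * q + \<delta> * s, a - \<epsilon> * p - \<epsilon> * q + \<delta> * s,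
      a - \<epsilon> * p + \<epsilon> * q - \<delta> * s, a + \<epsilon> * p - \<epsilon> * q - \<delta> * s] ! (i - 1)"

lemma indices: "{1..12} = {1, 2, 3, 4, 5, 6, 7, 8, 9, 10, 11, 12::nat}"
  by (simp add: atLeastAtMost_def atLeast_def atMost_def set_eq_iff) presburger

lemma inner_sym_mat:
  "A \<bullet> sym_mat a b c p q s =
     a * A $ 1 $ 1 + b * A $ 2 $ 2 + c * A $ 3 $ 3
     + p * (A $ 1 $ 2 + A $ 2 $ 1) + q * (A $ 1 $ 3 + A $ 3 $ 1) + s * (A $ 2 $ 3 + A $ 3 $ 2)"
  by (simp add: sym_mat_def inner_vec_def sum_3 algebra_simps)

lemma sym_mat_component [simp]:
  "sym_mat a b c p q s $ 1 $ 1 = a" "sym_mat a b c p q s $ 1 $ 2 = p"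
  "sym_mat a b c p q s $ 1 $ 3 = q" "sym_mat a b c p q s $ 2 $ 1 = p"
  "sym_mat a b c p q s $ 2 $ 2 = b" "sym_mat a b c p q s $ 2 $ 3 = s"
  "sym_mat a b c p q s $ 3 $ 1 = q" "sym_mat a b c p q s $ 3 $ 2 = s"
  "sym_mat a b c p q s $ 3 $ 3 = c"
  by (simp_all add: sym_mat_def)

lemma inner_strain:
  assumes "i \<in> {1..12}"
  shows "A \<bullet> strain \<alpha> \<beta> \<delta> \<epsilon> i =
    \<alpha> * (A $ 1 $ 1 + A $ 2 $ 2 + A $ 3 $ 3)
    + height \<delta> \<epsilon> ((\<beta> - \<alpha>) * A $ 1 $ 1) ((\<beta> - \<alpha>) * A $ 2 $ 2) ((\<beta> - \<alpha>) * A $ 3 $ 3)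
        (A $ 1 $ 2 + A $ 2 $ 1) (A $ 1 $ 3 + A $ 3 $ 1) (A $ 2 $ 3 + A $ 3 $ 2) i"
  using assms unfolding indices
  by (elim insertE emptyE) (simp_all add: strain_def height_def inner_sym_mat algebra_simps)

lemma strain_inner_self:
  assumes "i \<in> {1..12}"
  shows "strain \<alpha> \<beta> \<delta> \<epsilon> i \<bullet> strain \<alpha> \<beta> \<delta> \<epsilon> i = 2 * \<alpha>\<^sup>2 + \<beta>\<^sup>2 + 2 * \<delta>\<^sup>2 + 4 * \<epsilon>\<^sup>2"
  using assms unfolding indices
  by (elim insertE emptyE) (simp_all add: strain_def inner_sym_mat power2_eq_square)

lemma vertices_strain_hull:
  assumes "I \<subseteq> {1..12}"
  shows "vertices (strain_hull \<alpha> \<beta> \<delta> \<epsilon> I) = strain \<alpha> \<beta> \<delta> \<epsilon> ` I"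
  unfolding vertices_def strain_hull_def
proof (rule extreme_points_of_cospherical)
  show "compact (strain \<alpha> \<beta> \<delta> \<epsilon> ` I)"
    using assms finite_subset by (blast intro: finite_imp_compact)
  show "x \<bullet> x = 2 * \<alpha>\<^sup>2 + \<beta>\<^sup>2 + 2 * \<delta>\<^sup>2 + 4 * \<epsilon>\<^sup>2" if "x \<in> strain \<alpha> \<beta> \<delta> \<epsilon> ` I" for x
    using that assms strain_inner_self by blast
qed

lemma inj_on_strain:
  assumes "\<delta> > 0" "\<epsilon> > 0" "\<alpha> \<noteq> \<beta>"
  shows "inj_on (strain \<alpha> \<beta> \<delta> \<epsilon>) {1..12}"
proof -
  have sym_mat_eq: "sym_mat a b c p q s = sym_mat a' b' c' p' q' s' \<longleftrightarrow>
      a = a' \<and> b = b' \<and> c = c' \<and> p = p' \<and> q = q' \<and> s = s'" for a b c p q s a' b' c' p' q' s'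
    by (metis sym_mat_component)
  show ?thesis
    unfolding indices using assms
    by (simp add: strain_def sym_mat_eq)
qed

section \<open>Symmetries\<close>

text \<open>
  Permutations of the strain indices induced by conjugating the matrices with signed
  permutation matrices: exchanging the second and third axis, exchanging the first and second axis,
  and reversing the third axis. They generate a group of order 24.
\<close>

definition swap_pq :: "nat \<Rightarrow> nat" where
  "swap_pq i = [5, 6, 7, 8, 1, 2, 3, 4, 9, 10, 12, 11] ! (i - 1)"

definition swap_qs :: "nat \<Rightarrow> nat" where
  "swap_qs i = [1, 2, 4, 3, 9, 10, 11, 12, 5, 6, 7, 8] ! (i - 1)"

definition flip_qs :: "nat \<Rightarrow> nat" where
  "flip_qs i = [2, 1, 4, 3, 8, 7, 6, 5, 12, 11, 10, 9] ! (i - 1)"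

definition involution_on :: "'a set \<Rightarrow> ('a \<Rightarrow> 'a) \<Rightarrow> bool" where
  "involution_on X f \<longleftrightarrow> (\<forall>x\<in>X. f x \<in> X \<and> f (f x) = x)"

lemma involutions:
  "involution_on {1..12} swap_pq" "involution_on {1..12} swap_qs" "involution_on {1..12} flip_qs"
  unfolding involution_on_def indices by (simp_all add: swap_pq_def swap_qs_def flip_qs_def)

lemma height_symmetries:
  assumes "i \<in> {1..12}"
  shows "height \<delta> \<epsilon> a b c p q s (swap_pq i) = height \<delta> \<epsilon> a c b q p s i"
    and "height \<delta> \<epsilon> a b c p q s (swap_qs i) = height \<delta> \<epsilon> b a c p s q i"
    and "height \<delta> \<epsilon> a b c p q s (flip_qs i) = height \<delta> \<epsilon> a b c p (- q) (- s) i"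
  using assms unfolding indices
  by (elim insertE emptyE; simp add: height_def swap_pq_def swap_qs_def flip_qs_def)+

definition facet_indices :: "nat set set" where
  "facet_indices = r0_image_facets \<union> r0_invariant_facets
     \<union> three_tuple_pair_facets \<union> eight_vertex_facets"

lemma facet_indices_subset: "I \<in> facet_indices \<Longrightarrow> I \<subseteq> {1..12}"
proof -
  have "\<forall>I\<in>facet_indices. I \<subseteq> {1..12}" by code_simp
  then show "I \<in> facet_indices \<Longrightarrow> I \<subseteq> {1..12}" by blast
qed

lemma card_facet_indices: "card facet_indices = 33"
  by code_simp

lemma facet_indices_antichain:
  assumes "I \<in> facet_indices" "J \<in> facet_indices" "I \<subseteq> J"
  shows "I = J"
proof -
  have "\<forall>I\<in>facet_indices. \<forall>J\<in>facet_indices. I \<subseteq> J \<longrightarrow> I = J" by code_simp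
  with assms show ?thesis by blast
qed

lemma facet_indices_symmetric:
  "(`) swap_pq ` facet_indices \<subseteq> facet_indices"
  "(`) swap_qs ` facet_indices \<subseteq> facet_indices"
  "(`) flip_qs ` facet_indices \<subseteq> facet_indices"
  by code_simp+

definition adjoin_images :: "nat set set \<Rightarrow> nat set set" where
  "adjoin_images X = X \<union> (`) swap_pq ` X \<union> (`) swap_qs ` X \<union> (`) flip_qs ` X"

text \<open>
  Four rounds of adjoining images already fill the orbits: each element is the image of its
  representative under a product of at most four generators.
\<close>

lemma facet_indices_orbits:
  "facet_indices = (adjoin_images ^^ 4)
     {{1, 2, 5, 8, 9, 12}, {1, 4, 5, 8, 9}, {1, 2, 4, 8, 9}, {1, 2, 3, 4, 5, 6, 7, 8}}"
  by code_simp

section \<open>Every listed index set is cut out by a supporting hyperplane\<close>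

text \<open>
  The threshold is normalised to zero, which is possible because a common constant can be
  absorbed in \<open>a\<close>, \<open>b\<close> and \<open>c\<close>.
\<close>

definition exposed :: "real \<Rightarrow> real \<Rightarrow> nat set \<Rightarrow> bool" where
  "exposed \<delta> \<epsilon> I \<longleftrightarrow> I \<subseteq> {1..12} \<and> (\<exists>a b c p q s. \<forall>i\<in>{1..12}.
     height \<delta> \<epsilon> a b c p q s i \<le> 0 \<and> (height \<delta> \<epsilon> a b c p q s i = 0 \<longleftrightarrow> i \<in> I))"

lemma exposedI:
  assumes "I \<subseteq> {1..12}"
    and "\<And>i. i \<in> {1..12} \<Longrightarrow>
      height \<delta> \<epsilon> a b c p q s i \<le> 0 \<and> (height \<delta> \<epsilon> a b c p q s i = 0 \<longleftrightarrow> i \<in> I)"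
  shows "exposed \<delta> \<epsilon> I"
  using assms unfolding exposed_def by blast

lemma exposed_image:
  assumes "involution_on {1..12} \<pi>"
    and "\<And>a b c p q s. \<exists>a' b' c' p' q' s'. \<forall>i\<in>{1..12}.
      height \<delta> \<epsilon> a b c p q s (\<pi> i) = height \<delta> \<epsilon> a' b' c' p' q' s' i"
    and "exposed \<delta> \<epsilon> I"
  shows "exposed \<delta> \<epsilon> (\<pi> ` I)"
proof -
  have I: "I \<subseteq> {1..12}"
    using assms(3) by (simp add: exposed_def)
  obtain a b c p q s where h: "\<forall>i\<in>{1..12}.
      height \<delta> \<epsilon> a b c p q s i \<le> 0 \<and> (height \<delta> \<epsilon> a b c p q s i = 0 \<longleftrightarrow> i \<in> I)"
    using assms(3) unfolding exposed_def by blast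
  obtain a' b' c' p' q' s' where h': "\<forall>i\<in>{1..12}.
      height \<delta> \<epsilon> a b c p q s (\<pi> i) = height \<delta> \<epsilon> a' b' c' p' q' s' i"
    using assms(2) by meson
  have \<pi>: "\<pi> i \<in> {1..12}" "\<pi> (\<pi> i) = i" if "i \<in> {1..12}" for i
    using assms(1) that unfolding involution_on_def by blast+
  have mem: "\<pi> i \<in> I \<longleftrightarrow> i \<in> \<pi> ` I" if "i \<in> {1..12}" for i
    using I \<pi> that by (metis imageE image_eqI subsetD)
  show ?thesis
  proof (rule exposedI)
    show "\<pi> ` I \<subseteq> {1..12}"
      using I \<pi>(1) by blast
  next
    fix i :: nat assume i: "i \<in> {1..12}"
    show "height \<delta> \<epsilon> a' b' c' p' q' s' i \<le> 0
        \<and> (height \<delta> \<epsilon> a' b' c' p' q' s' i = 0 \<longleftrightarrow> i \<in> \<pi> ` I)"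
      using h[rule_format, OF \<pi>(1)[OF i]] h'[rule_format, OF i] mem[OF i] by simp
  qed
qed

lemma exposed_adjoin_images:
  assumes X: "\<And>I. I \<in> X \<Longrightarrow> exposed \<delta> \<epsilon> I" and "I \<in> adjoin_images X"
  shows "exposed \<delta> \<epsilon> I"
proof -
  have "exposed \<delta> \<epsilon> (swap_pq ` J)" if "J \<in> X" for J
    by (rule exposed_image[OF involutions(1) _ X[OF that]]) (use height_symmetries(1) in blast)
  moreover have "exposed \<delta> \<epsilon> (swap_qs ` J)" if "J \<in> X" for J
    by (rule exposed_image[OF involutions(2) _ X[OF that]]) (use height_symmetries(2) in blast)
  moreover have "exposed \<delta> \<epsilon> (flip_qs ` J)" if "J \<in> X" for J
    by (rule exposed_image[OF involutions(3) _ X[OF that]]) (use height_symmetries(3) in blast)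
  ultimately show ?thesis
    using assms unfolding adjoin_images_def by blast
qed

text \<open>
  The directions are the rays \<open>(1, 0, 0)\<close>, \<open>(\<epsilon>, \<epsilon>, - \<delta>)\<close>, \<open>(\<epsilon>, \<delta>, - \<delta>)\<close> of the chamber, and zero. In
  the first three cases the constants are the negated maxima of the direction over the three
  tetrahedra, so that every class touches the hyperplane.
\<close>

lemma exposed_representatives:
  assumes "0 < \<delta>" "\<delta> < \<epsilon>"
    and "I \<in> {{1, 2, 5, 8, 9, 12}, {1, 4, 5, 8, 9}, {1, 2, 4, 8, 9}, {1, 2, 3, 4, 5, 6, 7, 8}}"
  shows "exposed \<delta> \<epsilon> I"
proof -
  have \<epsilon>: "0 < \<epsilon>" using assms by simp
  have mono: "\<delta> * \<delta> < \<delta> * \<epsilon>" "\<delta> * \<epsilon> < \<epsilon> * \<epsilon>" "0 < \<delta> * \<delta>" "\<delta> \<noteq> 0" "\<epsilon> \<noteq> 0" "\<delta> \<noteq> \<epsilon>"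
    using assms by simp_all
  have "exposed \<delta> \<epsilon> {1, 2, 5, 8, 9, 12}"
  proof (rule exposedI)
    fix i :: nat assume "i \<in> {1..12}"
    then show "height \<delta> \<epsilon> (- \<epsilon>) (- \<epsilon>) (- \<delta>) 1 0 0 i \<le> 0
        \<and> (height \<delta> \<epsilon> (- \<epsilon>) (- \<epsilon>) (- \<delta>) 1 0 0 i = 0 \<longleftrightarrow> i \<in> {1, 2, 5, 8, 9, 12})"
      using assms \<epsilon> unfolding indices
      by (elim insertE emptyE) (simp_all add: height_def algebra_simps)
  qed simp
  moreover have "exposed \<delta> \<epsilon> {1, 4, 5, 8, 9}"
  proof (rule exposedI)
    fix i :: nat assume "i \<in> {1..12}"
    then show "height \<delta> \<epsilon> (\<delta> * \<delta> - 2 * (\<epsilon> * \<epsilon>)) (- (\<epsilon> * \<epsilon>)) (- (\<epsilon> * \<epsilon>)) \<epsilon> \<epsilon> (- \<delta>) i \<le> 0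
        \<and> (height \<delta> \<epsilon> (\<delta> * \<delta> - 2 * (\<epsilon> * \<epsilon>)) (- (\<epsilon> * \<epsilon>)) (- (\<epsilon> * \<epsilon>)) \<epsilon> \<epsilon> (- \<delta>) i = 0 \<longleftrightarrow> i \<in> {1, 4, 5, 8, 9})"
      using mono unfolding indices
      by (elim insertE emptyE) (simp_all add: height_def algebra_simps)
  qed simp
  moreover have "exposed \<delta> \<epsilon> {1, 2, 4, 8, 9}"
  proof (rule exposedI)
    fix i :: nat assume "i \<in> {1..12}"
    then show "height \<delta> \<epsilon> (\<delta> * \<delta> - \<epsilon> * \<epsilon> - \<delta> * \<epsilon>) (\<delta> * \<delta> - \<epsilon> * \<epsilon> - \<delta> * \<epsilon>) (- (\<delta> * \<epsilon>)) \<epsilon> \<delta> (- \<delta>) i \<le> 0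
        \<and> (height \<delta> \<epsilon> (\<delta> * \<delta> - \<epsilon> * \<epsilon> - \<delta> * \<epsilon>) (\<delta> * \<delta> - \<epsilon> * \<epsilon> - \<delta> * \<epsilon>) (- (\<delta> * \<epsilon>)) \<epsilon> \<delta> (- \<delta>) i = 0 \<longleftrightarrow> i \<in> {1, 2, 4, 8, 9})"
      using mono unfolding indices
      by (elim insertE emptyE) (simp_all add: height_def algebra_simps)
  qed simp
  moreover have "exposed \<delta> \<epsilon> {1, 2, 3, 4, 5, 6, 7, 8}"
  proof (rule exposedI)
    fix i :: nat assume "i \<in> {1..12}"
    then show "height \<delta> \<epsilon> (- 1) 0 0 0 0 0 i \<le> 0
        \<and> (height \<delta> \<epsilon> (- 1) 0 0 0 0 0 i = 0 \<longleftrightarrow> i \<in> {1, 2, 3, 4, 5, 6, 7, 8})"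
      unfolding indices
      by (elim insertE emptyE) (simp_all add: height_def algebra_simps)
  qed simp
  ultimately show ?thesis
    using assms(3) by blast
qed

lemma exposed_facet_indices:
  assumes "0 < \<delta>" "\<delta> < \<epsilon>" "I \<in> facet_indices"
  shows "exposed \<delta> \<epsilon> I"
proof -
  have "\<forall>I \<in> (adjoin_images ^^ n)
      {{1, 2, 5, 8, 9, 12}, {1, 4, 5, 8, 9}, {1, 2, 4, 8, 9}, {1, 2, 3, 4, 5, 6, 7, 8}}.
      exposed \<delta> \<epsilon> I" for n
  proof (induction n)
    case 0
    then show ?case
      using exposed_representatives[OF assms(1,2)] by simp
  next
    case (Suc n)
    then show ?case
      using exposed_adjoin_images by (simp only: funpow.simps o_apply) blast
  qed
  then show ?thesis
    using assms(3) unfolding facet_indices_orbits by blast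
qed

section \<open>Every supporting hyperplane meets the strains inside a listed index set\<close>

definition covered :: "real \<Rightarrow> real \<Rightarrow> real \<Rightarrow> real \<Rightarrow> real \<Rightarrow> bool" where
  "covered \<delta> \<epsilon> p q s \<longleftrightarrow> (\<forall>a b c. (\<forall>i\<in>{1..12}. height \<delta> \<epsilon> a b c p q s i \<le> 0) \<longrightarrow>
     (\<exists>I\<in>facet_indices. {i \<in> {1..12}. height \<delta> \<epsilon> a b c p q s i = 0} \<subseteq> I))"

lemma covered_image:
  assumes "involution_on {1..12} \<pi>" and "(`) \<pi> ` facet_indices \<subseteq> facet_indices"
    and "\<And>a b c. \<exists>a' b' c'. \<forall>i\<in>{1..12}.
      height \<delta> \<epsilon> a b c p q s (\<pi> i) = height \<delta> \<epsilon> a' b' c' p' q' s' i"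
    and "covered \<delta> \<epsilon> p' q' s'"
  shows "covered \<delta> \<epsilon> p q s"
  unfolding covered_def
proof (intro allI impI)
  fix a b c
  assume le: "\<forall>i\<in>{1..12}. height \<delta> \<epsilon> a b c p q s i \<le> 0"
  have \<pi>: "\<pi> i \<in> {1..12}" "\<pi> (\<pi> i) = i" if "i \<in> {1..12}" for i
    using assms(1) that unfolding involution_on_def by blast+
  obtain a' b' c' where h': "\<forall>i\<in>{1..12}.
      height \<delta> \<epsilon> a b c p q s (\<pi> i) = height \<delta> \<epsilon> a' b' c' p' q' s' i"
    using assms(3) by meson
  then have "\<forall>i\<in>{1..12}. height \<delta> \<epsilon> a' b' c' p' q' s' i \<le> 0"
    using le \<pi>(1) by metis
  then obtain I where I: "I \<in> facet_indices"
      "{i \<in> {1..12}. height \<delta> \<epsilon> a' b' c' p' q' s' i = 0} \<subseteq> I"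
    using assms(4) unfolding covered_def by blast
  have "i \<in> \<pi> ` I" if i: "i \<in> {1..12}" "height \<delta> \<epsilon> a b c p q s i = 0" for i
  proof -
    have "height \<delta> \<epsilon> a' b' c' p' q' s' (\<pi> i) = 0"
      using h' \<pi>[OF i(1)] i(2) by metis
    then have "\<pi> i \<in> I"
      using I(2) \<pi>(1)[OF i(1)] by blast
    then show ?thesis
      using \<pi>(2)[OF i(1)] by (metis imageI)
  qed
  then show "\<exists>I\<in>facet_indices. {i \<in> {1..12}. height \<delta> \<epsilon> a b c p q s i = 0} \<subseteq> I"
    using I(1) assms(2) by blast
qed

lemma covered_swap_pq: "covered \<delta> \<epsilon> q p s \<Longrightarrow> covered \<delta> \<epsilon> p q s"
  by (rule covered_image[OF involutions(1) facet_indices_symmetric(1)])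
    (use height_symmetries(1) in blast)

lemma covered_swap_qs: "covered \<delta> \<epsilon> p s q \<Longrightarrow> covered \<delta> \<epsilon> p q s"
  by (rule covered_image[OF involutions(2) facet_indices_symmetric(2)])
    (use height_symmetries(2) in blast)

lemma covered_flip_qs: "covered \<delta> \<epsilon> p (- q) (- s) \<Longrightarrow> covered \<delta> \<epsilon> p q s"
  by (rule covered_image[OF involutions(3) facet_indices_symmetric(3)])
    (use height_symmetries(3) in blast)

text \<open>
  The case distinction follows the rays of the chamber. The strains 5 or 8, and 9, maximise the
  direction over their classes, and in the remaining class the maximum is at 1 or 4 according to the
  sign of \<open>\<delta> * p + \<epsilon> * s\<close>. In each case the direction has a positive component along the ray whose
  facet is claimed, apart from the last case: there it may be a multiple of \<open>(1, 1, - 1)\<close>, which is a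
  positive combination of three rays congruent to \<open>(\<epsilon>, \<delta>, - \<delta>)\<close> and is covered by the same facet.
  Concretely, every strain outside the facet lies strictly below another one of its class.
\<close>

lemma covered_chamber:
  assumes \<delta>: "0 < \<delta>" "\<delta> < \<epsilon>" and chamber: "\<bar>s\<bar> \<le> q" "q \<le> p" "0 < p"
  shows "covered \<delta> \<epsilon> p q s"
  unfolding covered_def
proof (intro allI impI)
  fix a b c
  assume "\<forall>i\<in>{1..12}. height \<delta> \<epsilon> a b c p q s i \<le> 0"
  then have le: "height \<delta> \<epsilon> a b c p q s 1 \<le> 0" "height \<delta> \<epsilon> a b c p q s 4 \<le> 0"
      "height \<delta> \<epsilon> a b c p q s 5 \<le> 0" "height \<delta> \<epsilon> a b c p q s 8 \<le> 0"
      "height \<delta> \<epsilon> a b c p q s 9 \<le> 0"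
    by simp_all
  note le = le[unfolded height_def, simplified]
  have \<epsilon>: "0 < \<epsilon>" using \<delta> by simp
  have pos: "0 < \<delta> * p" "\<delta> * p < \<epsilon> * p" "0 \<le> \<delta> * q" "\<delta> * q \<le> \<epsilon> * q" 
      "\<epsilon> * q \<le> \<epsilon> * p" "\<delta> * q \<le> \<delta> * p" "- (\<epsilon> * q) \<le> \<epsilon> * s" "\<epsilon> * s \<le> \<epsilon> * q"
      "- (\<delta> * q) \<le> \<delta> * s" "\<delta> * s \<le> \<delta> * q"
    using \<delta> \<epsilon> chamber mult_left_mono[of "- q" s \<epsilon>] mult_left_mono[of "- q" s \<delta>]
    by (auto intro!: mult_left_mono mult_right_mono simp: abs_le_iff)
  consider (A) "0 < \<delta> * p + \<epsilon> * s" | (B) "\<delta> * p + \<epsilon> * s \<le> 0" "- s < q"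
    | (C) "\<delta> * p + \<epsilon> * s \<le> 0" "q = - s"
    using chamber by linarith
  then show "\<exists>I\<in>facet_indices. {i \<in> {1..12}. height \<delta> \<epsilon> a b c p q s i = 0} \<subseteq> I"
  proof cases
    case A
    have "height \<delta> \<epsilon> a b c p q s 3 < 0" "height \<delta> \<epsilon> a b c p q s 4 < 0"
        "height \<delta> \<epsilon> a b c p q s 6 < 0" "height \<delta> \<epsilon> a b c p q s 7 < 0"
        "height \<delta> \<epsilon> a b c p q s 10 < 0" "height \<delta> \<epsilon> a b c p q s 11 < 0"
      using A pos le by (simp_all add: height_def)
    then have "{i \<in> {1..12}. height \<delta> \<epsilon> a b c p q s i = 0} \<subseteq> {1, 2, 5, 8, 9, 12}"
      unfolding indices by auto
    moreover have "{1, 2, 5, 8, 9, 12} \<in> facet_indices"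
      by (simp add: facet_indices_def three_tuple_pair_facets_def)
    ultimately show ?thesis by blast
  next
    case B
    then have "\<epsilon> * s < 0" using pos by linarith
    then have "0 < q" using \<epsilon> B by (simp add: mult_less_0_iff)
    then have strict: "\<delta> * q < \<epsilon> * q" "- (\<epsilon> * s) < \<epsilon> * q"
      using \<delta> \<epsilon> B mult_strict_left_mono[of "- s" q \<epsilon>] by auto
    have "height \<delta> \<epsilon> a b c p q s 2 < 0" "height \<delta> \<epsilon> a b c p q s 3 < 0"
        "height \<delta> \<epsilon> a b c p q s 6 < 0" "height \<delta> \<epsilon> a b c p q s 7 < 0"
        "height \<delta> \<epsilon> a b c p q s 10 < 0" "height \<delta> \<epsilon> a b c p q s 11 < 0"
        "height \<delta> \<epsilon> a b c p q s 12 < 0"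
      using B strict pos le by (simp_all add: height_def)
    then have "{i \<in> {1..12}. height \<delta> \<epsilon> a b c p q s i = 0} \<subseteq> {1, 4, 5, 8, 9}"
      unfolding indices by auto
    moreover have "{1, 4, 5, 8, 9} \<in> facet_indices"
      by (simp add: facet_indices_def r0_invariant_facets_def)
    ultimately show ?thesis by blast
  next
    case C
    then have "\<epsilon> * s < 0" using pos by linarith
    then have "0 < q" using \<epsilon> C by (simp add: mult_less_0_iff)
    then have strict: "\<delta> * q < \<epsilon> * q" using \<delta> by simp
    have "height \<delta> \<epsilon> a b c p q s 3 < 0" "height \<delta> \<epsilon> a b c p q s 5 < 0"
        "height \<delta> \<epsilon> a b c p q s 6 < 0" "height \<delta> \<epsilon> a b c p q s 7 < 0"
        "height \<delta> \<epsilon> a b c p q s 10 < 0" "height \<delta> \<epsilon> a b c p q s 11 < 0"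
        "height \<delta> \<epsilon> a b c p q s 12 < 0"
      using C strict pos le by (simp_all add: height_def)
    then have "{i \<in> {1..12}. height \<delta> \<epsilon> a b c p q s i = 0} \<subseteq> {1, 2, 4, 8, 9}"
      unfolding indices by auto
    moreover have "{1, 2, 4, 8, 9} \<in> facet_indices"
      by (simp add: facet_indices_def r0_image_facets_def)
    ultimately show ?thesis by blast
  qed
qed

text \<open>
  Coordinate swaps sort the absolute values, and the sign changes of two coordinates at a time then make
  the two largest coordinates nonnegative.
\<close>

lemma covered_all:
  assumes "0 < \<delta>" "\<delta> < \<epsilon>" "\<not> (p = 0 \<and> q = 0 \<and> s = 0)"
  shows "covered \<delta> \<epsilon> p q s"
proof -
  have abs_sorted: "covered \<delta> \<epsilon> p q s" if *: "\<bar>s\<bar> \<le> \<bar>q\<bar>" "\<bar>q\<bar> \<le> \<bar>p\<bar>" "p \<noteq> 0" for p q s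
  proof -
    have q_nonneg: "covered \<delta> \<epsilon> p q s" if "0 < p" "\<bar>s\<bar> \<le> \<bar>q\<bar>" "\<bar>q\<bar> \<le> p" for p q s
      using covered_chamber[OF assms(1,2), of s q p] covered_chamber[OF assms(1,2), of "- s" "- q" p]
        covered_flip_qs[of \<delta> \<epsilon> p q s] that by (cases "0 \<le> q") auto
    show ?thesis
    proof (cases "0 < p")
      case False
      have "covered \<delta> \<epsilon> (- p) (- q) s"
        using q_nonneg[of "- p" s "- q"] * False by auto
      then have "covered \<delta> \<epsilon> s (- p) (- q)"
        by (metis covered_swap_pq covered_swap_qs)
      then have "covered \<delta> \<epsilon> s p q"
        by (rule covered_flip_qs)
      then show ?thesis
        by (metis covered_swap_pq covered_swap_qs)
    qed (use q_nonneg * in auto)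
  qed
  have first_largest: "covered \<delta> \<epsilon> p q s" if "\<bar>q\<bar> \<le> \<bar>p\<bar>" "\<bar>s\<bar> \<le> \<bar>p\<bar>" "p \<noteq> 0" for p q s
    using that abs_sorted[of s q p] abs_sorted[of q s p] covered_swap_qs by (meson linear)
  have second_largest: "covered \<delta> \<epsilon> p q s" if "\<bar>p\<bar> \<le> \<bar>q\<bar>" "\<bar>s\<bar> \<le> \<bar>q\<bar>" "q \<noteq> 0" for p q s
    using that first_largest covered_swap_pq by blast
  consider "\<bar>q\<bar> \<le> \<bar>p\<bar>" "\<bar>s\<bar> \<le> \<bar>p\<bar>" "p \<noteq> 0" | "\<bar>p\<bar> \<le> \<bar>q\<bar>" "\<bar>s\<bar> \<le> \<bar>q\<bar>" "q \<noteq> 0"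
    | "\<bar>p\<bar> \<le> \<bar>s\<bar>" "\<bar>q\<bar> \<le> \<bar>s\<bar>" "s \<noteq> 0"
    using assms(3) by linarith
  then show ?thesis
    using first_largest second_largest covered_swap_qs by cases blast+
qed

lemma zero_set_in_facet_indices:
  assumes "0 < \<delta>" "\<delta> < \<epsilon>"
    and le: "\<forall>i\<in>{1..12}. height \<delta> \<epsilon> a b c p q s i \<le> 0"
    and less: "\<exists>i\<in>{1..12}. height \<delta> \<epsilon> a b c p q s i < 0"
  shows "\<exists>I\<in>facet_indices. {i \<in> {1..12}. height \<delta> \<epsilon> a b c p q s i = 0} \<subseteq> I"
proof (cases "p = 0 \<and> q = 0 \<and> s = 0")
  case False
  then show ?thesis
    using covered_all[OF assms(1,2)] le unfolding covered_def by blast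
next
  case True
  have eights: "{1, 2, 3, 4, 5, 6, 7, 8} \<in> facet_indices"
      "{1, 2, 3, 4, 9, 10, 11, 12} \<in> facet_indices" "{5, 6, 7, 8, 9, 10, 11, 12} \<in> facet_indices"
    by (simp_all add: facet_indices_def eight_vertex_facets_def)
  have "a < 0 \<or> b < 0 \<or> c < 0"
    using less True unfolding indices by (auto simp: height_def)
  then consider "a < 0" | "b < 0" | "c < 0" by blast
  then show ?thesis
  proof cases
    case 1
    then have "{i \<in> {1..12}. height \<delta> \<epsilon> a b c p q s i = 0} \<subseteq> {1, 2, 3, 4, 5, 6, 7, 8}"
      using True unfolding indices by (auto simp: height_def)
    with eights show ?thesis by blast
  next
    case 2
    then have "{i \<in> {1..12}. height \<delta> \<epsilon> a b c p q s i = 0} \<subseteq> {1, 2, 3, 4, 9, 10, 11, 12}"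
      using True unfolding indices by (auto simp: height_def)
    with eights show ?thesis by blast
  next
    case 3
    then have "{i \<in> {1..12}. height \<delta> \<epsilon> a b c p q s i = 0} \<subseteq> {5, 6, 7, 8, 9, 10, 11, 12}"
      using True unfolding indices by (auto simp: height_def)
    with eights show ?thesis by blast
  qed
qed

section \<open>Dimension of the hull\<close>

text \<open>
  The strains lie in the five-dimensional space of symmetric matrices with trace \<open>2 * \<alpha> + \<beta>\<close>, which
  is parametrised by the three off-diagonal and two diagonal entries. If they spanned less, some
  nonzero functional would be constant on them; comparing its values on the first class kills the
  direction, and comparing the classes kills the diagonal part because \<open>\<alpha> \<noteq> \<beta>\<close>.
\<close>

lemma aff_dim_strains:
  assumes "\<delta> > 0" "\<epsilon> > 0" "\<alpha> \<noteq> \<beta>"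
  shows "aff_dim (strain \<alpha> \<beta> \<delta> \<epsilon> ` {1..12}) = 5"
proof -
  define L :: "(real^3) \<times> real \<times> real \<Rightarrow> real^3^3" where
    "L = (\<lambda>(w, x, y). sym_mat x y (- x - y) (w $ 1) (w $ 2) (w $ 3))"
  have "linear L"
    by (rule linearI) (auto simp: L_def vec_eq_iff forall_3 algebra_simps split: prod.splits)
  moreover have "inj L"
  proof (rule injI)
    fix v v' assume "L v = L v'"
    then have "L v $ i $ j = L v' $ i $ j" for i j
      by simp
    from this[of 1 1] this[of 2 2] this[of 1 2] this[of 1 3] this[of 2 3]
    show "v = v'"
      by (cases v; cases v') (simp add: L_def vec_eq_iff forall_3)
  qed
  ultimately have aff_dim_L: "aff_dim ((+) (sym_mat \<alpha> \<alpha> \<beta> 0 0 0) ` L ` Z) = aff_dim Z" for Z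
    by (simp add: aff_dim_translation_eq)
  define z :: "nat \<Rightarrow> (real^3) \<times> real \<times> real" where
    "z i = [(vector [\<delta>, \<epsilon>, \<epsilon>], 0, 0), (vector [\<delta>, - \<epsilon>, - \<epsilon>], 0, 0),
            (vector [- \<delta>, - \<epsilon>, \<epsilon>], 0, 0), (vector [- \<delta>, \<epsilon>, - \<epsilon>], 0, 0),
            (vector [\<epsilon>, \<delta>, \<epsilon>], 0, \<beta> - \<alpha>), (vector [- \<epsilon>, \<delta>, - \<epsilon>], 0, \<beta> - \<alpha>),
            (vector [- \<epsilon>, - \<delta>, \<epsilon>], 0, \<beta> - \<alpha>), (vector [\<epsilon>, - \<delta>, - \<epsilon>], 0, \<beta> - \<alpha>),
            (vector [\<epsilon>, \<epsilon>, \<delta>], \<beta> - \<alpha>, 0), (vector [- \<epsilon>, - \<epsilon>, \<delta>], \<beta> - \<alpha>, 0),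
            (vector [- \<epsilon>, \<epsilon>, - \<delta>], \<beta> - \<alpha>, 0), (vector [\<epsilon>, - \<epsilon>, - \<delta>], \<beta> - \<alpha>, 0)]
           ! (i - 1)" for i
  have "strain \<alpha> \<beta> \<delta> \<epsilon> i = sym_mat \<alpha> \<alpha> \<beta> 0 0 0 + L (z i)" if "i \<in> {1..12}" for i
    using that unfolding indices
    by (elim insertE emptyE) (simp_all add: strain_def z_def L_def vec_eq_iff forall_3)
  then have "strain \<alpha> \<beta> \<delta> \<epsilon> ` {1..12} = (+) (sym_mat \<alpha> \<alpha> \<beta> 0 0 0) ` L ` z ` {1..12}"
    unfolding image_image by (intro image_cong) auto
  then have "aff_dim (strain \<alpha> \<beta> \<delta> \<epsilon> ` {1..12}) = aff_dim (z ` {1..12})"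
    using aff_dim_L by simp
  also have "\<dots> = 5"
  proof (rule antisym)
    have DIM: "DIM((real^3) \<times> real \<times> real) = 5"
      by simp
    then show "aff_dim (z ` {1..12}) \<le> 5"
      by (metis aff_dim_le_DIM of_nat_numeral)
    show "5 \<le> aff_dim (z ` {1..12})"
    proof (rule ccontr)
      assume "\<not> 5 \<le> aff_dim (z ` {1..12})"
      then obtain n t where n: "n \<noteq> 0" and nt: "z ` {1..12} \<subseteq> {v. n \<bullet> v = t}"
        using aff_lowdim_subset_hyperplane[of "z ` {1..12}"] DIM by (metis not_le of_nat_numeral)
      obtain w x y where wxy: "n = (w, x, y)"
        by (cases n)
      have eq: "n \<bullet> z i = t" if "i \<in> {1..12}" for i
        using nt that by blast
      have "n \<bullet> z i = height \<delta> \<epsilon> ((\<beta> - \<alpha>) * x) ((\<beta> - \<alpha>) * y) 0 (w $ 1) (w $ 2) (w $ 3) i"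
        if "i \<in> {1..12}" for i
        using that unfolding indices wxy
        by (elim insertE emptyE)
          (simp_all add: z_def height_def inner_vec_def sum_3 algebra_simps)
      then have h: "height \<delta> \<epsilon> ((\<beta> - \<alpha>) * x) ((\<beta> - \<alpha>) * y) 0 (w $ 1) (w $ 2) (w $ 3) i = t"
        if "i \<in> {1..12}" for i
        using eq that by simp
      have "\<delta> * w $ 1 = 0" "\<epsilon> * w $ 2 = 0" "\<epsilon> * w $ 3 = 0"
        using h[of 1, unfolded height_def, simplified] h[of 2, unfolded height_def, simplified]
          h[of 3, unfolded height_def, simplified] h[of 4, unfolded height_def, simplified]
        by linarith+
      then have w: "w $ 1 = 0" "w $ 2 = 0" "w $ 3 = 0"
        using assms by simp_all
      then have "x = 0" "y = 0"
        using h[of 1] h[of 5] h[of 9] assms by (simp_all add: height_def)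
      with w n wxy show False
        by (simp add: vec_eq_iff forall_3 zero_prod_def)
    qed
  qed
  finally show ?thesis .
qed

section \<open>Compatible triples\<close>

lemma compatible_sym: "compatible e f \<Longrightarrow> compatible f e"
proof -
  assume "compatible e f"
  then obtain a b where "e - f = (1/2) *\<^sub>R (outer a b + outer b a)"
    by (auto simp: compatible_def)
  then have "f - e = (1/2) *\<^sub>R (outer (- a) b + outer b (- a))"
    by (simp add: outer_def vec_eq_iff algebra_simps)
  then show ?thesis
    unfolding compatible_def by blast
qed

text \<open>
  Two strains from different classes but with the same sign pattern \<open>(x, y, z)\<close> differ by a matrix
  whose quadratic form splits into two real linear factors. For the first pair the form is
  \<open>(u2 - z * u3) * ((\<alpha> - \<beta>) * (u2 + z * u3) - 2 * x * (\<epsilon> - \<delta>) * u1)\<close>; the coefficient vectors of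
  the two factors are the witnesses. The condition \<open>z = x * y\<close> holds for all strains.
\<close>

lemma compatible_same_signs:
  assumes "x\<^sup>2 = 1" "y\<^sup>2 = 1" "z = x * y"
  shows "compatible (sym_mat \<alpha> \<alpha> \<beta> (x * \<delta>) (y * \<epsilon>) (z * \<epsilon>)) (sym_mat \<alpha> \<beta> \<alpha> (x * \<epsilon>) (y * \<delta>) (z * \<epsilon>))"
    and "compatible (sym_mat \<alpha> \<alpha> \<beta> (x * \<delta>) (y * \<epsilon>) (z * \<epsilon>)) (sym_mat \<beta> \<alpha> \<alpha> (x * \<epsilon>) (y * \<epsilon>) (z * \<delta>))"
    and "compatible (sym_mat \<alpha> \<beta> \<alpha> (x * \<epsilon>) (y * \<delta>) (z * \<epsilon>)) (sym_mat \<beta> \<alpha> \<alpha> (x * \<epsilon>) (y * \<epsilon>) (z * \<delta>))"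
proof -
  have sq: "x * x = 1" "y * y = 1" "x * (x * c) = c" "y * (y * c) = c" for c
    using assms(1,2) by (simp_all add: power2_eq_square flip: mult.assoc)
  have compatibleI: "compatible e f" if "e - f = (1/2) *\<^sub>R (outer a b + outer b a)" for e f a b
    using that by (auto simp: compatible_def)
  show "compatible (sym_mat \<alpha> \<alpha> \<beta> (x * \<delta>) (y * \<epsilon>) (z * \<epsilon>)) (sym_mat \<alpha> \<beta> \<alpha> (x * \<epsilon>) (y * \<delta>) (z * \<epsilon>))"
    by (rule compatibleI[where a = "vector [0, 1, - z]"
          and b = "vector [- 2 * x * (\<epsilon> - \<delta>), \<alpha> - \<beta>, (\<alpha> - \<beta>) * z]"])
      (simp add: vec_eq_iff forall_3 outer_def sq assms(3) algebra_simps
        add_divide_distrib diff_divide_distrib)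
  show "compatible (sym_mat \<alpha> \<alpha> \<beta> (x * \<delta>) (y * \<epsilon>) (z * \<epsilon>)) (sym_mat \<beta> \<alpha> \<alpha> (x * \<epsilon>) (y * \<epsilon>) (z * \<delta>))"
    by (rule compatibleI[where a = "vector [1, 0, - y]"
          and b = "vector [\<alpha> - \<beta>, - 2 * x * (\<epsilon> - \<delta>), (\<alpha> - \<beta>) * y]"])
      (simp add: vec_eq_iff forall_3 outer_def sq assms(3) algebra_simps
        add_divide_distrib diff_divide_distrib)
  show "compatible (sym_mat \<alpha> \<beta> \<alpha> (x * \<epsilon>) (y * \<delta>) (z * \<epsilon>)) (sym_mat \<beta> \<alpha> \<alpha> (x * \<epsilon>) (y * \<epsilon>) (z * \<delta>))"
    by (rule compatibleI[where a = "vector [1, - x, 0]"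
          and b = "vector [\<alpha> - \<beta>, (\<alpha> - \<beta>) * x, - 2 * y * (\<epsilon> - \<delta>)]"])
      (simp add: vec_eq_iff forall_3 outer_def sq assms(3) algebra_simps
        add_divide_distrib diff_divide_distrib)
qed

lemma compatible_triples:
  assumes "T \<in> {{1, 5, 9}, {2, 8, 12}, {3, 7, 10}, {4, 6, 11}}"
  shows "pairwise compatible (strain \<alpha> \<beta> \<delta> \<epsilon> ` T)"
proof -
  have triple: "pairwise compatible {e, f, g}"
    if "compatible e f" "compatible e g" "compatible f g" for e f g
    using that compatible_sym by (auto simp: pairwise_def)
  have "pairwise compatible (strain \<alpha> \<beta> \<delta> \<epsilon> ` {1, 5, 9})"
    using triple compatible_same_signs[where x = 1 and y = 1 and z = 1] by (simp add: strain_def)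
  moreover have "pairwise compatible (strain \<alpha> \<beta> \<delta> \<epsilon> ` {2, 8, 12})"
    using triple compatible_same_signs[where x = 1 and y = "- 1" and z = "- 1"] by (simp add: strain_def)
  moreover have "pairwise compatible (strain \<alpha> \<beta> \<delta> \<epsilon> ` {3, 7, 10})"
    using triple compatible_same_signs[where x = "- 1" and y = "- 1" and z = 1] by (simp add: strain_def)
  moreover have "pairwise compatible (strain \<alpha> \<beta> \<delta> \<epsilon> ` {4, 6, 11})"
    using triple compatible_same_signs[where x = "- 1" and y = 1 and z = "- 1"] by (simp add: strain_def)
  ultimately show ?thesis
    using assms by blast
qed

text \<open>
  The four triples are the strains with a common sign pattern, and the six facets are the unions of
  two of these triples.
\<close>

lemma three_tuple_pair_facets_split:
  assumes "I \<in> three_tuple_pair_facets"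
  obtains T U where "T \<in> {{1, 5, 9}, {2, 8, 12}, {3, 7, 10}, {4, 6, 11}}"
    "U \<in> {{1, 5, 9}, {2, 8, 12}, {3, 7, 10}, {4, 6, 11}}" "I = T \<union> U" "T \<inter> U = {}"
proof -
  have "\<forall>I\<in>three_tuple_pair_facets.
      \<exists>T\<in>{{1, 5, 9}, {2, 8, 12}, {3, 7, 10}, {4, 6, 11}}.
      \<exists>U\<in>{{1, 5, 9}, {2, 8, 12}, {3, 7, 10}, {4, 6, 11}}. I = T \<union> U \<and> T \<inter> U = {}"
    by code_simp
  from bspec[OF this assms] show ?thesis
    by (elim bexE conjE) (rule that)
qed

section \<open>The facets\<close>

lemma strain_hull_subset_iff:
  assumes "\<delta> > 0" "\<epsilon> > 0" "\<alpha> \<noteq> \<beta>" "I \<subseteq> {1..12}" "J \<subseteq> {1..12}"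
  shows "strain_hull \<alpha> \<beta> \<delta> \<epsilon> I \<subseteq> strain_hull \<alpha> \<beta> \<delta> \<epsilon> J \<longleftrightarrow> I \<subseteq> J"
proof
  assume *: "strain_hull \<alpha> \<beta> \<delta> \<epsilon> I \<subseteq> strain_hull \<alpha> \<beta> \<delta> \<epsilon> J"
  show "I \<subseteq> J"
  proof
    fix i assume i: "i \<in> I"
    have "strain \<alpha> \<beta> \<delta> \<epsilon> i \<in> strain_hull \<alpha> \<beta> \<delta> \<epsilon> J"
      using * i unfolding strain_hull_def by (blast intro: hull_inc)
    moreover have "strain_hull \<alpha> \<beta> \<delta> \<epsilon> J \<subseteq> strain_hull \<alpha> \<beta> \<delta> \<epsilon> {1..12}"
      unfolding strain_hull_def using assms(5) by (intro hull_mono image_mono)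
    moreover have "strain \<alpha> \<beta> \<delta> \<epsilon> i \<in> vertices (strain_hull \<alpha> \<beta> \<delta> \<epsilon> {1..12})"
      using vertices_strain_hull[of "{1..12}"] i assms(4) by blast
    ultimately have "strain \<alpha> \<beta> \<delta> \<epsilon> i \<in> vertices (strain_hull \<alpha> \<beta> \<delta> \<epsilon> J)"
      unfolding vertices_def extreme_point_of_def by blast
    then have "strain \<alpha> \<beta> \<delta> \<epsilon> i \<in> strain \<alpha> \<beta> \<delta> \<epsilon> ` J"
      using vertices_strain_hull[OF assms(5)] by simp
    then show "i \<in> J"
      using inj_on_image_mem_iff[OF inj_on_strain[OF assms(1-3)]] i assms(4,5) by blast
  qed
next
  assume "I \<subseteq> J"
  then show "strain_hull \<alpha> \<beta> \<delta> \<epsilon> I \<subseteq> strain_hull \<alpha> \<beta> \<delta> \<epsilon> J"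
    unfolding strain_hull_def by (intro hull_mono image_mono)
qed

lemma inj_on_strain_hull:
  assumes "\<delta> > 0" "\<epsilon> > 0" "\<alpha> \<noteq> \<beta>"
  shows "inj_on (strain_hull \<alpha> \<beta> \<delta> \<epsilon>) (Pow {1..12})"
proof (rule inj_onI)
  fix I J assume "I \<in> Pow {1..12::nat}" "J \<in> Pow {1..12::nat}"
    and eq: "strain_hull \<alpha> \<beta> \<delta> \<epsilon> I = strain_hull \<alpha> \<beta> \<delta> \<epsilon> J"
  then have "I \<subseteq> {1..12}" "J \<subseteq> {1..12}"
    by blast+
  from strain_hull_subset_iff[OF assms this] strain_hull_subset_iff[OF assms this(2,1)] eq
  show "I = J" by simp
qed

lemma exposed_face:
  assumes "\<alpha> \<noteq> \<beta>" "exposed \<delta> \<epsilon> I"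
  shows "strain_hull \<alpha> \<beta> \<delta> \<epsilon> I face_of strain_hull \<alpha> \<beta> \<delta> \<epsilon> {1..12}"
proof -
  obtain a b c p q s where I: "I \<subseteq> {1..12}" and h: "\<forall>i\<in>{1..12}.
      height \<delta> \<epsilon> a b c p q s i \<le> 0 \<and> (height \<delta> \<epsilon> a b c p q s i = 0 \<longleftrightarrow> i \<in> I)"
    using assms(2) unfolding exposed_def by blast
  \<comment> \<open>The trace of A shifts all values equally; it cannot be prescribed together with a, b, c when
      the trace of the strains vanishes, so it is put into the threshold.\<close>
  define A where "A = sym_mat (a / (\<beta> - \<alpha>)) (b / (\<beta> - \<alpha>)) (c / (\<beta> - \<alpha>)) (p / 2) (q / 2) (s / 2)"
  define t where "t = \<alpha> * (A $ 1 $ 1 + A $ 2 $ 2 + A $ 3 $ 3)"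
  have A: "A \<bullet> strain \<alpha> \<beta> \<delta> \<epsilon> i = t + height \<delta> \<epsilon> a b c p q s i" if "i \<in> {1..12}" for i
    unfolding inner_strain[OF that] t_def using assms(1) by (simp add: A_def)
  have iff: "A \<bullet> strain \<alpha> \<beta> \<delta> \<epsilon> i = t \<longleftrightarrow> i \<in> I" and le: "A \<bullet> strain \<alpha> \<beta> \<delta> \<epsilon> i \<le> t"
    if "i \<in> {1..12}" for i
    using A[OF that] h[rule_format, OF that] by simp_all
  have "{x \<in> strain \<alpha> \<beta> \<delta> \<epsilon> ` {1..12}. A \<bullet> x = t} = strain \<alpha> \<beta> \<delta> \<epsilon> ` I"
    using iff I by blast
  moreover have "A \<bullet> x \<le> t" if "x \<in> strain \<alpha> \<beta> \<delta> \<epsilon> ` {1..12}" for x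
    using that le by blast
  ultimately show ?thesis
    using face_of_convex_hull_supporting(1)[of "strain \<alpha> \<beta> \<delta> \<epsilon> ` {1..12}" A t]
    unfolding strain_hull_def by simp
qed

lemma facets_strain_hull:
  assumes "0 < \<delta>" "\<delta> < \<epsilon>" "\<alpha> \<noteq> \<beta>"
  shows "{F. F facet_of strain_hull \<alpha> \<beta> \<delta> \<epsilon> {1..12}} = strain_hull \<alpha> \<beta> \<delta> \<epsilon> ` facet_indices"
proof -
  let ?e = "strain \<alpha> \<beta> \<delta> \<epsilon>"
  have \<epsilon>: "\<epsilon> > 0" using assms by simp
  have full: "{1..12} \<notin> facet_indices"
    by code_simp
  have empty: "{} \<notin> facet_indices"
    by code_simp
  have "{F. F facet_of convex hull (?e ` {1..12})} = (hull) convex ` (`) ?e ` facet_indices"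
  proof (rule facets_of_convex_hull)
    show "finite (?e ` {1..12})" by simp
  next
    fix T assume "T \<in> (`) ?e ` facet_indices"
    then obtain I where I: "I \<in> facet_indices" "T = ?e ` I" by blast
    show "convex hull T face_of convex hull ?e ` {1..12}"
      using exposed_face[OF assms(3) exposed_facet_indices[OF assms(1,2) I(1)]] I(2)
      by (simp add: strain_hull_def)
    have "I \<noteq> {1..12}"
      using full I(1) by blast
    then show "convex hull T \<noteq> convex hull ?e ` {1..12}"
      using inj_on_strain_hull[OF assms(1) \<epsilon> assms(3)] facet_indices_subset[OF I(1)] I(2)
      unfolding strain_hull_def inj_on_def by blast
    show "T \<noteq> {}"
      using empty I by blast
  next
    fix A b
    assume le: "\<forall>x\<in>?e ` {1..12}. A \<bullet> x \<le> b" and less: "\<exists>x\<in>?e ` {1..12}. A \<bullet> x < b"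
    define t where "t = (b - \<alpha> * (A $ 1 $ 1 + A $ 2 $ 2 + A $ 3 $ 3))"
    define h where "h = height \<delta> \<epsilon> ((\<beta> - \<alpha>) * A $ 1 $ 1 - t) ((\<beta> - \<alpha>) * A $ 2 $ 2 - t)
      ((\<beta> - \<alpha>) * A $ 3 $ 3 - t)
      (A $ 1 $ 2 + A $ 2 $ 1) (A $ 1 $ 3 + A $ 3 $ 1) (A $ 2 $ 3 + A $ 3 $ 2)"
    have shift: "height \<delta> \<epsilon> (x - t) (y - t) (z - t) p q s i = height \<delta> \<epsilon> x y z p q s i - t"
      if "i \<in> {1..12}" for x y z p q s i
      using that unfolding indices by (elim insertE emptyE) (simp_all add: height_def)
    have A: "A \<bullet> ?e i = b + h i" if "i \<in> {1..12}" for i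
      unfolding inner_strain[OF that] h_def shift[OF that] by (simp add: t_def)
    have iff: "A \<bullet> ?e i = b \<longleftrightarrow> h i = 0" "A \<bullet> ?e i \<le> b \<longleftrightarrow> h i \<le> 0" "A \<bullet> ?e i < b \<longleftrightarrow> h i < 0"
      if "i \<in> {1..12}" for i
      using A[OF that] by simp_all
    have "\<forall>i\<in>{1..12}. h i \<le> 0" "\<exists>i\<in>{1..12}. h i < 0"
      using le less iff by blast+
    then obtain I where I: "I \<in> facet_indices" "{i \<in> {1..12}. h i = 0} \<subseteq> I"
      unfolding h_def using zero_set_in_facet_indices[OF assms(1,2)] by blast
    have "{x \<in> ?e ` {1..12}. A \<bullet> x = b} = ?e ` {i \<in> {1..12}. h i = 0}"
      using iff(1) by blast
    then have "{x \<in> ?e ` {1..12}. A \<bullet> x = b} \<subseteq> ?e ` I"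
      using image_mono[OF I(2)] by (simp only:)
    then show "\<exists>T\<in>(`) ?e ` facet_indices. {x \<in> ?e ` {1..12}. A \<bullet> x = b} \<subseteq> T"
      using I(1) by (intro bexI[of _ "?e ` I"] imageI)
  next
    fix T T'
    assume "T \<in> (`) ?e ` facet_indices" "T' \<in> (`) ?e ` facet_indices"
      and sub: "convex hull T \<subseteq> convex hull T'"
    then obtain I J where IJ: "I \<in> facet_indices" "T = ?e ` I" "J \<in> facet_indices" "T' = ?e ` J"
      by blast
    have "strain_hull \<alpha> \<beta> \<delta> \<epsilon> I \<subseteq> strain_hull \<alpha> \<beta> \<delta> \<epsilon> J"
      using sub unfolding strain_hull_def IJ(2,4) .
    then have "I \<subseteq> J"
      using strain_hull_subset_iff[OF assms(1) \<epsilon> assms(3) facet_indices_subset[OF IJ(1)]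
          facet_indices_subset[OF IJ(3)]] by simp
    with IJ show "T = T'"
      using facet_indices_antichain by blast
  qed
  then show ?thesis
    by (simp only: strain_hull_def[abs_def] image_image)
qed

theorem mainTheorem5:
  fixes \<alpha> \<beta> \<delta> \<epsilon> :: real
  assumes "\<delta> > 0" and "\<epsilon> > 0"
    and "\<alpha> \<noteq> \<beta>"
    and "(\<alpha> - \<beta>) * \<delta> + \<epsilon>\<^sup>2 - \<delta>\<^sup>2 \<noteq> 0"
    and "\<epsilon> > \<delta>"
  shows "let K = strain_hull \<alpha> \<beta> \<delta> \<epsilon>;
             facets = {F. F facet_of K {1..12}}
         in
           facets = K ` (r0_image_facets \<union> r0_invariant_facets
                              \<union> three_tuple_pair_facets \<union> eight_vertex_facets)
         \<and> card facets = 33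
         \<and> (\<forall>F\<in>facets. aff_dim F = 4)
         \<and> (\<forall>I \<in> r0_image_facets \<union> r0_invariant_facets
                  \<union> three_tuple_pair_facets \<union> eight_vertex_facets.
              vertices (K I) = strain \<alpha> \<beta> \<delta> \<epsilon> ` I)
         \<and> card (K ` r0_image_facets) = 12
         \<and> (\<forall>I\<in>r0_image_facets. card (vertices (K I)) = 5)
         \<and> r0_image_facets = (\<lambda>I. r0 ` I) ` five_vertex_small_eps
         \<and> card (K ` r0_invariant_facets) = 12
         \<and> K ` r0_invariant_facets \<inter> K ` r0_image_facets = {}
         \<and> (\<forall>I\<in>r0_invariant_facets. card (vertices (K I)) = 5)
         \<and> (\<lambda>I. r0 ` I) ` r0_invariant_facets = r0_invariant_facets
         \<and> card (K ` three_tuple_pair_facets) = 6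
         \<and> (\<forall>I\<in>three_tuple_pair_facets.
              \<exists>T U. vertices (K I) = T \<union> U \<and> T \<inter> U = {}
                \<and> card T = 3 \<and> card U = 3
                \<and> pairwise compatible T \<and> pairwise compatible U)
         \<and> card (K ` eight_vertex_facets) = 3
         \<and> (\<forall>I\<in>eight_vertex_facets. card (vertices (K I)) = 8 \<and> r0 ` I = I)"
proof -
  let ?K = "strain_hull \<alpha> \<beta> \<delta> \<epsilon>" and ?e = "strain \<alpha> \<beta> \<delta> \<epsilon>"
  have inj_e: "inj_on ?e I" if "I \<subseteq> {1..12}" for I
    using inj_on_strain[OF assms(1-3)] that by (rule inj_on_subset)
  have inj_K: "inj_on ?K \<I>" if "\<I> \<subseteq> facet_indices" for \<I>
    using inj_on_strain_hull[OF assms(1-3)] by (rule inj_on_subset) (use that facet_indices_subset in blast)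
  have facets: "{F. F facet_of ?K {1..12}} = ?K ` facet_indices"
    using assms by (intro facets_strain_hull) auto
  have families: "r0_image_facets \<subseteq> facet_indices" "r0_invariant_facets \<subseteq> facet_indices"
      "three_tuple_pair_facets \<subseteq> facet_indices" "eight_vertex_facets \<subseteq> facet_indices"
    by (auto simp: facet_indices_def)
  have vertices_K: "vertices (?K I) = ?e ` I" if "I \<in> facet_indices" for I
    using vertices_strain_hull facet_indices_subset[OF that] by blast
  have card_vertices: "card (vertices (?K I)) = card I" if "I \<in> facet_indices" for I
    using vertices_K[OF that] card_image[OF inj_e[OF facet_indices_subset[OF that]]] by simp
  have card_K: "card (?K ` \<I>) = card \<I>" if "\<I> \<subseteq> facet_indices" for \<I>
    using card_image[OF inj_K[OF that]] .
  have cards: "card r0_image_facets = 12" "card r0_invariant_facets = 12"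
      "card three_tuple_pair_facets = 6" "card eight_vertex_facets = 3"
      "\<forall>I\<in>r0_image_facets. card I = 5" "\<forall>I\<in>r0_invariant_facets. card I = 5"
      "\<forall>I\<in>eight_vertex_facets. card I = 8"
    by code_simp+
  have r0: "r0_image_facets = (\<lambda>I. r0 ` I) ` five_vertex_small_eps"
      "(\<lambda>I. r0 ` I) ` r0_invariant_facets = r0_invariant_facets"
      "\<forall>I\<in>eight_vertex_facets. r0 ` I = I"
    by code_simp+
  have "r0_invariant_facets \<inter> r0_image_facets = {}"
    by code_simp
  then have disjoint: "?K ` r0_invariant_facets \<inter> ?K ` r0_image_facets = {}"
    using inj_on_image_Int[OF inj_K[OF order_refl] families(2,1)] by simp
  have aff_dim: "aff_dim F = 4" if "F facet_of ?K {1..12}" for F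
    using that aff_dim_strains[OF assms(1-3)]
    unfolding facet_of_def strain_hull_def aff_dim_convex_hull by simp
  have pairs: "\<exists>T U. vertices (?K I) = T \<union> U \<and> T \<inter> U = {} \<and> card T = 3 \<and> card U = 3
      \<and> pairwise compatible T \<and> pairwise compatible U" if "I \<in> three_tuple_pair_facets" for I
  proof -
    obtain T U where T: "T \<in> {{1, 5, 9}, {2, 8, 12}, {3, 7, 10}, {4, 6, 11}}"
      and U: "U \<in> {{1, 5, 9}, {2, 8, 12}, {3, 7, 10}, {4, 6, 11}}"
      and TU: "I = T \<union> U" "T \<inter> U = {}"
      using three_tuple_pair_facets_split[OF \<open>I \<in> three_tuple_pair_facets\<close>] .
    have I: "I \<in> facet_indices"
      using that families(3) by blast
    have sub: "T \<subseteq> {1..12}" "U \<subseteq> {1..12}"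
      using facet_indices_subset[OF I] TU by auto
    have "card T = 3" "card U = 3"
      using T U by auto
    then have "card (?e ` T) = 3" "card (?e ` U) = 3"
      using sub card_image[OF inj_e] by simp_all
    moreover have "vertices (?K I) = ?e ` T \<union> ?e ` U"
      using vertices_K[OF I] TU(1) by (simp add: image_Un)
    moreover have "?e ` T \<inter> ?e ` U = {}"
      using inj_on_image_Int[OF inj_e[OF order_refl] sub] TU(2) by simp
    ultimately show ?thesis
      using compatible_triples[OF T] compatible_triples[OF U]
      by (intro exI[of _ "?e ` T"] exI[of _ "?e ` U"] conjI)
  qed
  have "card (?K ` facet_indices) = 33"
      "card (?K ` r0_image_facets) = 12" "card (?K ` r0_invariant_facets) = 12"
      "card (?K ` three_tuple_pair_facets) = 6" "card (?K ` eight_vertex_facets) = 3"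
    using card_K families cards(1-4) card_facet_indices by simp_all
  moreover have "\<forall>I\<in>r0_image_facets. card (vertices (?K I)) = 5"
      "\<forall>I\<in>r0_invariant_facets. card (vertices (?K I)) = 5"
      "\<forall>I\<in>eight_vertex_facets. card (vertices (?K I)) = 8 \<and> r0 ` I = I"
    using card_vertices families cards(5-7) r0(3) by (metis subsetD)+
  moreover have "\<forall>F \<in> ?K ` facet_indices. aff_dim F = 4"
    using aff_dim facets by blast
  moreover have "\<forall>I\<in>facet_indices. vertices (?K I) = ?e ` I"
    using vertices_K by blast
  moreover have "\<forall>I\<in>three_tuple_pair_facets. \<exists>T U. vertices (?K I) = T \<union> U \<and> T \<inter> U = {}
      \<and> card T = 3 \<and> card U = 3 \<and> pairwise compatible T \<and> pairwise compatible U"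
    using pairs by blast
  ultimately show ?thesis
    unfolding Let_def facet_indices_def[symmetric] facets using disjoint r0(1,2)
    by (simp only: simp_thms)
qed

end
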